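(* Let $n\ge 1$ and $P\in D_n$. Then the pseudocomplement $\sim\! P$ of $P$ in the Heyting algebra $D_n$ is obtained from $P$ by (1) replacing each maximal sequence of $k\ge 0$ consecutive hills of $P$, starting at abscissa $x$ and ending at abscissa $x'$, with a pyramid (of the suitable height) starting at abscissa $\max(0,x-2)$ and ending at abscissa $\min(x'+2,2n)$, and (2) completing the path by hills. That is, $\sim\! P$ is the Dyck path of semilength $n$ consisting of the pyramids described in (1) together with hills on all the remaining portions of $[0,2n]$.
   Context: A Dyck path of semilength $n$ is a lattice path from $(0,0)$ to $(2n,0)$ using steps $u=(1,1)$ and $d=(1,-1)$ and never going below the $x$-axis. $D_n$ is the set of Dyck paths of semilength $n$, ordered by $P\le Q$ iff $P$ lies weakly below $Q$; it is a finite distributive lattice with minimum $0=(ud)^n$, hence a Heyting algebra with relative pseudocomplement $P\rightsquigarrow Q=\bigvee\{Z\in D_n : P\wedge Z\le Q\}$ and pseudocomplement $\sim\! P=P\rightsquigarrow 0$. A factor of a Dyck path is a minimal nonempty subsequence of consecutive steps starting and ending on the $x$-axis. A pyramid is a subsequence of consecutive steps of the form $u^kd^k$ ($k\ge 1$) starting and ending on the $x$-axis. A hill is a factor $ud$ (a pyramid with $k=1$), also called a trivial factor. A return is a point of the path on the $x$-axis other than the starting point. By convention, a "sequence of $0$ consecutive hills" is a point of the path on the $x$-axis, other than the starting and ending points, which is neither preceded nor followed by a hill (i.e. a return between two nontrivial factors); in this case $x=x'$ is the abscissa of that point. *)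

theory Defs
  imports "HOL-Algebra.Complete_Lattice"
begin

datatype step = U | D

fun rise :: "step \<Rightarrow> int" where
  "rise U = 1"
| "rise D = -1"

text \<open>The ordinate of the path \<open>P\<close> at the abscissa \<open>i\<close> (meaningful for \<open>i \<le> length P\<close>).\<close>

definition height :: "step list \<Rightarrow> nat \<Rightarrow> int" where
  "height P i = (\<Sum>s\<leftarrow>take i P. rise s)"

definition Dyck :: "nat \<Rightarrow> step list set" where
  "Dyck n = {P. length P = 2 * n \<and> (\<forall>i\<le>2 * n. 0 \<le> height P i) \<and> height P (2 * n) = 0}"

text \<open>Paths are linear between consecutive integer abscissas, so lying weakly below can be tested
  at the integer abscissas.\<close>

definition weakly_below :: "nat \<Rightarrow> step list \<Rightarrow> step list \<Rightarrow> bool" where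
  "weakly_below n P Q \<longleftrightarrow> (\<forall>i\<le>2 * n. height P i \<le> height Q i)"

definition Dyck_order :: "nat \<Rightarrow> step list gorder" where
  "Dyck_order n = \<lparr>carrier = Dyck n, eq = (=), le = weakly_below n\<rparr>"

definition zero_path :: "nat \<Rightarrow> step list" where
  "zero_path n = concat (replicate n [U, D])"

definition rel_pseudocomplement :: "nat \<Rightarrow> step list \<Rightarrow> step list \<Rightarrow> step list" where
  "rel_pseudocomplement n P Q =
     \<Squnion>\<^bsub>Dyck_order n\<^esub> {Z \<in> Dyck n. (P \<sqinter>\<^bsub>Dyck_order n\<^esub> Z) \<sqsubseteq>\<^bsub>Dyck_order n\<^esub> Q}"

definition pseudocomplement :: "nat \<Rightarrow> step list \<Rightarrow> step list" where
  "pseudocomplement n P = rel_pseudocomplement n P (zero_path n)"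


definition pyramid_at :: "step list \<Rightarrow> nat \<Rightarrow> nat \<Rightarrow> bool" where
  "pyramid_at P a b \<longleftrightarrow> height P a = 0 \<and> height P b = 0 \<and>
     (\<exists>k\<ge>1. b = a + 2 * k \<and> take (2 * k) (drop a P) = replicate k U @ replicate k D)"

definition hill_at :: "step list \<Rightarrow> nat \<Rightarrow> bool" where
  "hill_at P a \<longleftrightarrow> pyramid_at P a (a + 2)"

text \<open>For \<open>k = 0\<close> the sequence degenerates to a point of the path on the axis other than its two
  endpoints.\<close>

definition hill_sequence :: "step list \<Rightarrow> nat \<Rightarrow> nat \<Rightarrow> nat \<Rightarrow> bool" where
  "hill_sequence P k x x' \<longleftrightarrow> x' = x + 2 * k \<and> height P x = 0 \<and>
     (\<forall>i<k. hill_at P (x + 2 * i)) \<and> (k = 0 \<longrightarrow> 0 < x \<and> x < length P)"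

text \<open>Maximal means neither preceded nor followed by a hill; for \<open>k = 0\<close> this says that the point
  is a return between two nontrivial factors.\<close>

definition maximal_hill_sequence :: "step list \<Rightarrow> nat \<Rightarrow> nat \<Rightarrow> bool" where
  "maximal_hill_sequence P x x' \<longleftrightarrow> (\<exists>k. hill_sequence P k x x') \<and>
     \<not> (\<exists>a. a + 2 = x \<and> hill_at P a) \<and> \<not> hill_at P x'"

text \<open>The abscissas \<open>a\<close>, \<open>b\<close> between which a pyramid is placed. Subtraction on \<^typ>\<open>nat\<close> truncates,
  so \<open>x - 2\<close> is the mathematical \<open>max(0, x - 2)\<close>.\<close>

definition new_pyramid :: "nat \<Rightarrow> step list \<Rightarrow> nat \<Rightarrow> nat \<Rightarrow> bool" where
  "new_pyramid n P a b \<longleftrightarrow>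
     (\<exists>x x'. maximal_hill_sequence P x x' \<and> a = x - 2 \<and> b = min (x' + 2) (2 * n))"

text \<open>All abscissas \<open>a\<close>, \<open>b\<close> above are even, so the portions of \<open>[0, 2n]\<close> not covered by the
  pyramids are unions of intervals \<open>[2i, 2i + 2]\<close>.\<close>

definition pyramids_completed_by_hills :: "nat \<Rightarrow> step list \<Rightarrow> step list \<Rightarrow> bool" where
  "pyramids_completed_by_hills n P Q \<longleftrightarrow> Q \<in> Dyck n \<and>
     (\<forall>a b. new_pyramid n P a b \<longrightarrow> pyramid_at Q a b) \<and>
     (\<forall>i<n. \<not> (\<exists>a b. new_pyramid n P a b \<and> a \<le> 2 * i \<and> 2 * i + 2 \<le> b) \<longrightarrow> hill_at Q (2 * i))"


text \<open>The lattice operations above are the choice-based ones of \<open>HOL-Algebra\<close>. The following facts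
  show that they are meaningful: \<open>Dyck_order n\<close> is a finite lattice, so all joins of nonempty sets
  exist, and \<open>zero_path n\<close> is its minimum, so the set in \<open>pseudocomplement\<close> is nonempty.\<close>

lemma height_0 [simp]: "height P 0 = 0"
  by (simp add: height_def)

lemma height_Suc: "i < length P \<Longrightarrow> height P (Suc i) = height P i + rise (P ! i)"
  by (simp add: height_def take_Suc_conv_app_nth)

lemma rise_cases: "rise s = 1 \<or> rise s = -1"
  by (cases s) auto

lemma rise_inj: "rise s = rise t \<Longrightarrow> s = t"
  by (cases s; cases t) auto

lemma height_parity: "i \<le> length P \<Longrightarrow> even (height P i + int i)"
proof (induction i)
  case (Suc i)
  then show ?case using rise_cases[of "P ! i"] by (auto simp: height_Suc)
qed simp

lemma path_eqI:
  assumes "length P = m" "length Q = m" "\<And>i. i \<le> m \<Longrightarrow> height P i = height Q i"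
  shows "P = Q"
proof (rule nth_equalityI)
  fix i assume "i < length P"
  then have "height P (Suc i) = height Q (Suc i)" "height P i = height Q i" "i < length Q"
    using assms by auto
  then show "P ! i = Q ! i"
    using \<open>i < length P\<close> by (simp add: height_Suc rise_inj)
qed (use assms in simp)

definition path_of :: "nat \<Rightarrow> (nat \<Rightarrow> int) \<Rightarrow> step list" where
  "path_of m f = map (\<lambda>i. if f (Suc i) > f i then U else D) [0..<m]"

lemma length_path_of [simp]: "length (path_of m f) = m"
  by (simp add: path_of_def)

lemma height_path_of:
  assumes "f 0 = 0" "\<And>i. i < m \<Longrightarrow> \<bar>f (Suc i) - f i\<bar> = 1" "i \<le> m"
  shows "height (path_of m f) i = f i"
  using assms(3)
proof (induction i)
  case 0
  then show ?case by (simp add: assms(1))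
next
  case (Suc i)
  then have "height (path_of m f) (Suc i) = f i + rise (path_of m f ! i)"
    by (simp add: height_Suc)
  also have "path_of m f ! i = (if f (Suc i) > f i then U else D)"
    using Suc.prems by (simp add: path_of_def)
  also have "f i + rise \<dots> = f (Suc i)"
    using assms(2)[of i] Suc.prems by (auto simp: abs_if split: if_splits)
  finally show ?case .
qed

lemma height_step_extremum:
  assumes "length P = m" "length Q = m" "i < m"
  shows "\<bar>min (height P (Suc i)) (height Q (Suc i)) - min (height P i) (height Q i)\<bar> = 1"
    and "\<bar>max (height P (Suc i)) (height Q (Suc i)) - max (height P i) (height Q i)\<bar> = 1"
proof -
  have "even (height P i + int i)" "even (height Q i + int i)"
    using assms height_parity[of i P] height_parity[of i Q] by simp_all
  then have "even (height P i - height Q i)" by presburger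
  then obtain c where "height P i - height Q i = 2 * c" by (rule evenE)
  then have c: "height P i = height Q i + 2 * c" by simp
  have d: "c = 0 \<or> c \<ge> 1 \<or> c \<le> -1" by arith
  have e: "height P (Suc i) = height P i + rise (P ! i)" "height Q (Suc i) = height Q i + rise (Q ! i)"
    using assms by (auto simp: height_Suc)
  show "\<bar>min (height P (Suc i)) (height Q (Suc i)) - min (height P i) (height Q i)\<bar> = 1"
    using d rise_cases[of "P ! i"] rise_cases[of "Q ! i"] unfolding e c by (auto simp: min_def)
  show "\<bar>max (height P (Suc i)) (height Q (Suc i)) - max (height P i) (height Q i)\<bar> = 1"
    using d rise_cases[of "P ! i"] rise_cases[of "Q ! i"] unfolding e c by (auto simp: max_def)
qed

lemma Dyck_min:
  assumes "P \<in> Dyck n" "Q \<in> Dyck n"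
  obtains R where "R \<in> Dyck n" "\<And>i. i \<le> 2 * n \<Longrightarrow> height R i = min (height P i) (height Q i)"
proof -
  let ?f = "\<lambda>i. min (height P i) (height Q i)"
  have h: "height (path_of (2 * n) ?f) i = ?f i" if "i \<le> 2 * n" for i
    using that assms by (intro height_path_of height_step_extremum) (auto simp: Dyck_def)
  then have "path_of (2 * n) ?f \<in> Dyck n"
    using assms by (auto simp: Dyck_def)
  with h that show thesis by blast
qed

lemma Dyck_max:
  assumes "P \<in> Dyck n" "Q \<in> Dyck n"
  obtains R where "R \<in> Dyck n" "\<And>i. i \<le> 2 * n \<Longrightarrow> height R i = max (height P i) (height Q i)"
proof -
  let ?f = "\<lambda>i. max (height P i) (height Q i)"
  have h: "height (path_of (2 * n) ?f) i = ?f i" if "i \<le> 2 * n" for i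
    using that assms by (intro height_path_of height_step_extremum) (auto simp: Dyck_def)
  then have "path_of (2 * n) ?f \<in> Dyck n"
    using assms by (auto simp: Dyck_def le_max_iff_disj)
  with h that show thesis by blast
qed

lemma partial_order_Dyck: "partial_order (Dyck_order n)"
proof
  fix P Q assume "P \<sqsubseteq>\<^bsub>Dyck_order n\<^esub> Q" "Q \<sqsubseteq>\<^bsub>Dyck_order n\<^esub> P"
    "P \<in> carrier (Dyck_order n)" "Q \<in> carrier (Dyck_order n)"
  then show "P .=\<^bsub>Dyck_order n\<^esub> Q"
    by (auto simp: Dyck_order_def Dyck_def weakly_below_def intro!: path_eqI[of P "2 * n" Q] order.antisym)
qed (auto simp: Dyck_order_def weakly_below_def intro: order_trans)

lemma lattice_Dyck: "lattice (Dyck_order n)"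
proof -
  interpret partial_order "Dyck_order n" by (rule partial_order_Dyck)
  show ?thesis
  proof
    fix P Q assume PQ: "P \<in> carrier (Dyck_order n)" "Q \<in> carrier (Dyck_order n)"
    then obtain R where "R \<in> Dyck n" "\<And>i. i \<le> 2 * n \<Longrightarrow> height R i = max (height P i) (height Q i)"
      by (auto simp: Dyck_order_def elim: Dyck_max)
    with PQ have "least (Dyck_order n) R (Upper (Dyck_order n) {P, Q})"
      by (auto simp: least_def Upper_def Dyck_order_def weakly_below_def)
    then show "\<exists>s. least (Dyck_order n) s (Upper (Dyck_order n) {P, Q})" by blast
  next
    fix P Q assume PQ: "P \<in> carrier (Dyck_order n)" "Q \<in> carrier (Dyck_order n)"
    then obtain R where "R \<in> Dyck n" "\<And>i. i \<le> 2 * n \<Longrightarrow> height R i = min (height P i) (height Q i)"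
      by (auto simp: Dyck_order_def elim: Dyck_min)
    with PQ have "greatest (Dyck_order n) R (Lower (Dyck_order n) {P, Q})"
      by (auto simp: greatest_def Lower_def Dyck_order_def weakly_below_def)
    then show "\<exists>s. greatest (Dyck_order n) s (Lower (Dyck_order n) {P, Q})" by blast
  qed
qed

lemma finite_Dyck: "finite (Dyck n)"
proof -
  have "(UNIV :: step set) = {U, D}" by (auto intro: step.exhaust)
  then have "finite (UNIV :: step set)" by (metis finite.emptyI finite.insertI)
  then have "finite {P. set P \<subseteq> (UNIV :: step set) \<and> length P = 2 * n}"
    by (rule finite_lists_length_eq)
  then show ?thesis by (rule finite_subset[rotated]) (auto simp: Dyck_def)
qed

lemma length_zero_path [simp]: "length (zero_path n) = 2 * n"
  by (induction n) (auto simp: zero_path_def)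

lemma height_zero_path: "i \<le> 2 * n \<Longrightarrow> height (zero_path n) i = int (i mod 2)"
proof (induction n arbitrary: i)
  case (Suc n)
  have z: "zero_path (Suc n) = U # D # zero_path n" by (simp add: zero_path_def)
  consider "i = 0" | "i = 1" | j where "i = Suc (Suc j)" by (metis One_nat_def not0_implies_Suc)
  then show ?case
  proof cases
    case 3
    then show ?thesis using Suc by (simp add: z height_def)
  qed (simp_all add: z height_def)
qed simp

lemma zero_path_least: "least (Dyck_order n) (zero_path n) (carrier (Dyck_order n))"
proof -
  have "int (i mod 2) \<le> height P i" if "P \<in> Dyck n" "i \<le> 2 * n" for P i
  proof -
    have "even (height P i + int i)" "0 \<le> height P i"
      using that height_parity[of i P] by (auto simp: Dyck_def)
    then show ?thesis by presburger
  qed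
  then show ?thesis
    by (auto simp: least_def Dyck_order_def weakly_below_def height_zero_path Dyck_def)
qed

lemma Dyck_join_least:
  assumes "A \<subseteq> Dyck n" "A \<noteq> {}"
  shows "least (Dyck_order n) (\<Squnion>\<^bsub>Dyck_order n\<^esub> A) (Upper (Dyck_order n) A)"
proof -
  interpret lattice "Dyck_order n" by (rule lattice_Dyck)
  show ?thesis
    using assms finite_Dyck by (intro finite_sup_least) (auto simp: Dyck_order_def intro: finite_subset)
qed

end

theory Submission
  imports Defs
begin

text \<open>By parity, \<open>P \<sqinter> Z \<sqsubseteq> 0\<close> says exactly that \<open>Z\<close> touches the axis at every even abscissa where
  \<open>P\<close> does not. Together with the endpoints these abscissas form the set of forced zeros of \<open>Z\<close>. As
  paths are 1-Lipschitz, the largest such \<open>Z\<close> has as height the distance to the nearest forced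
  zero, so it consists of one pyramid between any two consecutive forced zeros. Two consecutive
  forced zeros at distance at least 4 enclose a maximal sequence of hills of \<open>P\<close>, and those at
  distance 2 carry a hill.\<close>

definition forced_zeros :: "nat \<Rightarrow> step list \<Rightarrow> nat set" where
  "forced_zeros n P = {0, 2 * n} \<union> {i. i \<le> 2 * n \<and> even i \<and> height P i \<noteq> 0}"

definition consecutive :: "nat set \<Rightarrow> nat \<Rightarrow> nat \<Rightarrow> bool" where
  "consecutive F a b \<longleftrightarrow> a \<in> F \<and> b \<in> F \<and> a < b \<and> (\<forall>c\<in>F. \<not> (a < c \<and> c < b))"

definition distance_to :: "nat set \<Rightarrow> nat \<Rightarrow> int" where
  "distance_to F i = Min ((\<lambda>c. \<bar>int i - int c\<bar>) ` F)"

section \<open>Consecutive elements of a finite set\<close>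

lemma consecutive_exists:
  assumes "finite F" "a \<in> F" "b \<in> F" "a \<le> i" "i < b"
  obtains a' b' where "consecutive F a' b'" "a' \<le> i" "i < b'"
proof
  \<comment> \<open>The neighbours of \<open>i\<close> in \<open>F\<close>, with \<open>i\<close>
    itself counted to the left: this half-open choice keeps the pair unique even if \<open>i\<close>
    lies in \<open>F\<close>.\<close>
  let ?l = "Max {c\<in>F. c \<le> i}" and ?r = "Min {c\<in>F. i < c}"
  have l: "?l \<in> {c\<in>F. c \<le> i}" and r: "?r \<in> {c\<in>F. i < c}"
    using assms by (intro Max_in Min_in; auto)+
  then show "?l \<le> i" "i < ?r" by auto
  have "c \<le> ?l \<or> ?r \<le> c" if "c \<in> F" for c
    using that assms(1) Max_ge[of "{c\<in>F. c \<le> i}" c] Min_le[of "{c\<in>F. i < c}" c]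
    by (cases "c \<le> i") simp_all
  then show "consecutive F ?l ?r"
    using l r unfolding consecutive_def by (fastforce simp: not_less)
qed

text \<open>Of two different left ends, the larger is still at most \<open>i\<close>, hence strictly
  inside the other interval; the smaller of two different right ends likewise.\<close>

lemma consecutive_unique:
  assumes "consecutive F a b" "consecutive F a' b'" "a \<le> i" "i < b" "a' \<le> i" "i < b'"
  shows "a = a'" "b = b'"
proof -
  have "\<not> a < a'" "\<not> a' < a" "\<not> b < b'" "\<not> b' < b"
    using assms unfolding consecutive_def by (meson le_less_trans less_le_trans)+
  then show "a = a'" "b = b'" by auto
qed

section \<open>Distance to a finite set of abscissas\<close>

lemma distance_to_le:
  assumes "finite F" "c \<in> F"
  shows "distance_to F i \<le> \<bar>int i - int c\<bar>"
  using assms unfolding distance_to_def by (intro Min_le) auto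

lemma distance_to_attained:
  assumes "finite F" "F \<noteq> {}"
  obtains c where "c \<in> F" "distance_to F i = \<bar>int i - int c\<bar>"
proof -
  have "distance_to F i \<in> (\<lambda>c. \<bar>int i - int c\<bar>) ` F"
    unfolding distance_to_def using assms by (intro Min_in) auto
  with that show thesis by auto
qed

text \<open>Testing the nearest element for one abscissa at the other shows that the change is at
  most 1. As all elements of \<open>F\<close> are even, the distance has the parity of the abscissa,
  so the change is odd. This is what \<open>height_path_of\<close> requires to realise the distance
  as the height of a path.\<close>

lemma distance_to_step:
  assumes "finite F" "F \<noteq> {}" "\<And>c. c \<in> F \<Longrightarrow> even c"
  shows "\<bar>distance_to F (Suc i) - distance_to F i\<bar> = 1"
proof -
  obtain c where c: "c \<in> F" "distance_to F i = \<bar>int i - int c\<bar>"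
    using assms distance_to_attained by metis
  obtain d where d: "d \<in> F" "distance_to F (Suc i) = \<bar>int (Suc i) - int d\<bar>"
    using assms distance_to_attained by metis
  have "distance_to F (Suc i) \<le> \<bar>int (Suc i) - int c\<bar>" "distance_to F i \<le> \<bar>int i - int d\<bar>"
    using assms c(1) d(1) by (simp_all only: distance_to_le)
  then have "\<bar>distance_to F (Suc i) - distance_to F i\<bar> \<le> 1"
    unfolding c d by linarith
  moreover have "odd (distance_to F (Suc i) - distance_to F i)"
    unfolding c d using assms(3)[OF c(1)] assms(3)[OF d(1)] by (auto simp: abs_if)
  ultimately show ?thesis by presburger
qed

lemma distance_to_consecutive:
  assumes "finite F" "consecutive F a b" "a \<le> i" "i \<le> b"
  shows "distance_to F i = min (int i - int a) (int b - int i)"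
proof -
  have ab: "a \<in> F" "b \<in> F" using assms by (auto simp: consecutive_def)
  obtain c where c: "c \<in> F" "distance_to F i = \<bar>int i - int c\<bar>"
    using assms ab distance_to_attained by (metis empty_iff)
  have "c \<le> a \<or> b \<le> c" using assms c by (auto simp: consecutive_def)
  moreover have "distance_to F i \<le> \<bar>int i - int a\<bar>" "distance_to F i \<le> \<bar>int i - int b\<bar>"
    using assms ab by (simp_all only: distance_to_le)
  ultimately show ?thesis using c assms by linarith
qed

lemma height_lipschitz:
  assumes "i \<le> j" "j \<le> length P"
  shows "\<bar>height P j - height P i\<bar> \<le> int j - int i"
  using assms
proof (induction j rule: dec_induct)
  case (step m)
  then show ?case using rise_cases[of "P ! m"] by (auto simp: height_Suc)
qed simp

text \<open>The Lipschitz bound is applied between \<open>i\<close> and the element of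
  \<open>F\<close> nearest to it, on whichever side it lies.\<close>

lemma height_le_distance_to:
  assumes "finite F" "F \<noteq> {}" "F \<subseteq> {..length Z}" "\<And>c. c \<in> F \<Longrightarrow> height Z c = 0" "i \<le> length Z"
  shows "height Z i \<le> distance_to F i"
proof -
  obtain c where c: "c \<in> F" "distance_to F i = \<bar>int i - int c\<bar>"
    using assms distance_to_attained by metis
  have "height Z c = 0" "c \<le> length Z" using assms c by auto
  then show ?thesis
    using c assms(5) height_lipschitz[of i c Z] height_lipschitz[of c i Z]
    by (cases "i \<le> c") auto
qed

section \<open>Pyramids and hills in terms of heights\<close>

lemma height_add: "height P (a + j) = height P a + height (drop a P) j"
  by (simp add: height_def take_add)

text \<open>The truncated difference \<open>j - k\<close> is 0 throughout the ascent and then counts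
  the down steps. Both terms are capped at \<open>k\<close>, since \<open>take\<close> stops at the
  end of the word.\<close>

lemma height_ramp:
  "height (replicate k U @ replicate k D) j = int (min j k) - int (min (j - k) k)"
  by (simp add: height_def sum_list_replicate)

text \<open>Trades the word of a pyramid for its height profile, the form in which it meets
  \<open>distance_to_consecutive\<close>. Conversely, the profile determines each step because
  \<open>rise\<close> is injective.\<close>

lemma pyramid_at_iff:
  "pyramid_at P a b \<longleftrightarrow> a < b \<and> even (b - a) \<and> b \<le> length P \<and>
     (\<forall>i. a \<le> i \<longrightarrow> i \<le> b \<longrightarrow> height P i = min (int i - int a) (int b - int i))"
  (is "_ \<longleftrightarrow> ?R")
proof
  assume "pyramid_at P a b"
  then obtain k where k: "k \<ge> 1" "b = a + 2 * k" "height P a = 0"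
    and t: "take (2 * k) (drop a P) = replicate k U @ replicate k D"
    by (auto simp: pyramid_at_def)
  \<comment> \<open>Comparing lengths shows that \<open>take\<close> is not cut short by the end of
    \<open>P\<close>.\<close>
  from arg_cong[OF t, of length] have len: "b \<le> length P" using k by auto
  have "height P i = min (int i - int a) (int b - int i)" if "a \<le> i" "i \<le> b" for i
  proof -
    define j where "j = i - a"
    have j: "i = a + j" "j \<le> 2 * k" using that k by (auto simp: j_def)
    have "height (drop a P) j = height (take (2 * k) (drop a P)) j"
      using j by (simp add: height_def min_def)
    then show ?thesis
      unfolding t j height_add height_ramp using k j by auto
  qed
  then show ?R using k len by auto
next
  assume R: ?R
  then obtain k where k: "b = a + 2 * k" by (metis evenE le_add_diff_inverse less_imp_le)
  have len: "a + 2 * k \<le> length P" using R k by simp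
  have h: "height P (a + j) = min (int j) (2 * int k - int j)" if "j \<le> 2 * k" for j
    using R k that by simp
  have "take (2 * k) (drop a P) = replicate k U @ replicate k D"
  proof (rule nth_equalityI)
    fix j assume "j < length (take (2 * k) (drop a P))"
    then have j: "j < 2 * k" by simp
    have "rise (P ! (a + j)) = height P (a + Suc j) - height P (a + j)"
      using j len by (simp add: height_Suc)
    also have "\<dots> = rise (if j < k then U else D)"
      using j by (simp only: h) auto
    finally have "P ! (a + j) = (if j < k then U else D)" by (rule rise_inj)
    then show "take (2 * k) (drop a P) ! j = (replicate k U @ replicate k D) ! j"
      using j len by (auto simp: nth_append)
  qed (use len in auto)
  then show "pyramid_at P a b"
    using R k h[of 0] h[of "2 * k"] by (auto simp: pyramid_at_def intro!: exI[of _ k])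
qed

lemma Dyck_even_zero:
  assumes "P \<in> Dyck n" "i \<le> 2 * n" "height P i = 0"
  shows "even i"
  using height_parity[of i P] assms by (auto simp: Dyck_def)

text \<open>A Dyck path cannot step below the axis, so between two axis points at distance 2 it has
  to go up and then down.\<close>

lemma hill_at_iff:
  assumes "P \<in> Dyck n"
  shows "hill_at P a \<longleftrightarrow> a + 2 \<le> 2 * n \<and> height P a = 0 \<and> height P (a + 2) = 0"
proof
  assume "hill_at P a"
  then show "a + 2 \<le> 2 * n \<and> height P a = 0 \<and> height P (a + 2) = 0"
    using assms by (auto simp: hill_at_def pyramid_at_iff Dyck_def)
next
  assume R: "a + 2 \<le> 2 * n \<and> height P a = 0 \<and> height P (a + 2) = 0"
  then have "height P (Suc a) = 1"
    using assms rise_cases[of "P ! a"] by (auto simp: Dyck_def height_Suc)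
      (metis Suc_leD height_Suc le_simps(3) neg_0_le_iff_le not_one_le_zero add_0)
  moreover have "i = a \<or> i = Suc a \<or> i = a + 2" if "a \<le> i" "i \<le> a + 2" for i
    using that by auto
  ultimately show "hill_at P a"
    using R assms by (force simp: hill_at_def pyramid_at_iff Dyck_def)
qed

section \<open>The pseudocomplement as a distance function\<close>

context
  fixes n :: nat and P :: "step list"
  assumes P: "P \<in> Dyck n"
begin

lemma forced_zeros_simps:
  "finite (forced_zeros n P)" "forced_zeros n P \<noteq> {}" "forced_zeros n P \<subseteq> {..2 * n}"
  "0 \<in> forced_zeros n P" "2 * n \<in> forced_zeros n P"
  by (auto simp: forced_zeros_def)

lemma even_forced_zeros: "c \<in> forced_zeros n P \<Longrightarrow> even c"
  by (auto simp: forced_zeros_def)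

lemma forced_zero_iff:
  "even c \<Longrightarrow> 0 < c \<Longrightarrow> c < 2 * n \<Longrightarrow> c \<in> forced_zeros n P \<longleftrightarrow> height P c \<noteq> 0"
  by (auto simp: forced_zeros_def)

text \<open>The meet is known only through its universal property; antisymmetry identifies it with
  the path of pointwise minima.\<close>

lemma height_meet:
  assumes "Z \<in> Dyck n" "i \<le> 2 * n"
  shows "height (P \<sqinter>\<^bsub>Dyck_order n\<^esub> Z) i = min (height P i) (height Z i)"
proof -
  interpret lattice "Dyck_order n" by (rule lattice_Dyck)
  obtain R where R: "R \<in> Dyck n" "\<And>i. i \<le> 2 * n \<Longrightarrow> height R i = min (height P i) (height Z i)"
    using P assms(1) by (auto elim: Dyck_min)
  have "P \<sqinter>\<^bsub>Dyck_order n\<^esub> Z = R"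
  proof (rule le_antisym)
    have c: "P \<in> carrier (Dyck_order n)" "Z \<in> carrier (Dyck_order n)" "R \<in> carrier (Dyck_order n)"
      using P assms R by (auto simp: Dyck_order_def)
    then show "P \<sqinter>\<^bsub>Dyck_order n\<^esub> Z \<in> carrier (Dyck_order n)" "R \<in> carrier (Dyck_order n)" by auto
    show "R \<sqsubseteq>\<^bsub>Dyck_order n\<^esub> P \<sqinter>\<^bsub>Dyck_order n\<^esub> Z"
      using c R by (intro meet_le) (auto simp: Dyck_order_def weakly_below_def)
    have "P \<sqinter>\<^bsub>Dyck_order n\<^esub> Z \<sqsubseteq>\<^bsub>Dyck_order n\<^esub> P" "P \<sqinter>\<^bsub>Dyck_order n\<^esub> Z \<sqsubseteq>\<^bsub>Dyck_order n\<^esub> Z"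
      using c by (auto intro: meet_left meet_right)
    then show "P \<sqinter>\<^bsub>Dyck_order n\<^esub> Z \<sqsubseteq>\<^bsub>Dyck_order n\<^esub> R"
      using R by (auto simp: Dyck_order_def weakly_below_def)
  qed
  then show ?thesis using R assms by simp
qed

text \<open>Heights are nonnegative, so at an even abscissa the bound says that \<open>P\<close> or
  \<open>Z\<close> is on the axis. At an odd abscissa the bound is 1 and comes for free: one of the
  paths is on the axis one step earlier.\<close>

lemma meet_le_zero_path_iff:
  assumes Z: "Z \<in> Dyck n"
  shows "(P \<sqinter>\<^bsub>Dyck_order n\<^esub> Z) \<sqsubseteq>\<^bsub>Dyck_order n\<^esub> zero_path n \<longleftrightarrow>
    (\<forall>c\<in>forced_zeros n P. height Z c = 0)" (is "?L \<longleftrightarrow> ?R")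
proof -
  have L: "?L \<longleftrightarrow> (\<forall>i\<le>2 * n. min (height P i) (height Z i) \<le> int (i mod 2))"
    by (simp add: Dyck_order_def weakly_below_def height_meet[OF Z, unfolded Dyck_order_def]
        height_zero_path)
  have nonneg: "0 \<le> height P i" "0 \<le> height Z i" if "i \<le> 2 * n" for i
    using P Z that by (auto simp: Dyck_def)
  show ?thesis
  proof
    assume ?L
    show ?R
    proof
      fix c assume c: "c \<in> forced_zeros n P"
      then have "c \<le> 2 * n" "even c" by (auto simp: forced_zeros_def)
      with \<open>?L\<close> have "min (height P c) (height Z c) \<le> 0" unfolding L by fastforce
      then show "height Z c = 0"
        using c Z nonneg[OF \<open>c \<le> 2 * n\<close>] by (auto simp: forced_zeros_def Dyck_def min_def split: if_splits)
    qed
  next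
    assume R: ?R
    have even_case: "height P i = 0 \<or> height Z i = 0" if "i \<le> 2 * n" "even i" for i
      using R that by (auto simp: forced_zeros_def)
    have "min (height P i) (height Z i) \<le> int (i mod 2)" if i: "i \<le> 2 * n" for i
    proof (cases "even i")
      case True
      then show ?thesis using even_case[OF i] nonneg[OF i] by auto
    next
      case False
      then obtain j where j: "i = Suc j" "even j" by (metis oddE add.commute plus_1_eq_Suc even_mult_iff even_numeral)
      then have "height P j = 0 \<or> height Z j = 0" using even_case i by simp
      moreover have "height P i \<le> height P j + 1" "height Z i \<le> height Z j + 1"
        using height_lipschitz[of j i P] height_lipschitz[of j i Z] j i P Z by (simp_all add: Dyck_def)
      ultimately show ?thesis using False by (auto simp: odd_iff_mod_2_eq_one)
    qed
    then show ?L unfolding L by blast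
  qed
qed

text \<open>The path \<open>?M\<close> whose height is the distance to the forced zeros is the
  largest member of the set \<open>?A\<close> being joined, and a path is determined by its
  heights.\<close>

lemma eq_pseudocomplement_iff:
  "Q = pseudocomplement n P \<longleftrightarrow>
    Q \<in> Dyck n \<and> (\<forall>i\<le>2 * n. height Q i = distance_to (forced_zeros n P) i)"
proof -
  let ?F = "forced_zeros n P"
  let ?A = "{Z \<in> Dyck n. (P \<sqinter>\<^bsub>Dyck_order n\<^esub> Z) \<sqsubseteq>\<^bsub>Dyck_order n\<^esub> zero_path n}"
  let ?M = "path_of (2 * n) (distance_to ?F)"
  have dist_zero: "distance_to ?F c = 0" if "c \<in> ?F" for c
  proof -
    obtain d where "distance_to ?F c = \<bar>int c - int d\<bar>"
      using distance_to_attained forced_zeros_simps by metis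
    then show ?thesis using distance_to_le[OF forced_zeros_simps(1) that, of c] by simp
  qed
  have hM: "height ?M i = distance_to ?F i" if "i \<le> 2 * n" for i
    using that forced_zeros_simps even_forced_zeros
    by (intro height_path_of distance_to_step) (auto simp: dist_zero)
  have nonneg: "0 \<le> distance_to ?F i" for i
    using distance_to_attained[OF forced_zeros_simps(1,2), of i] by (metis abs_ge_zero)
  have M: "?M \<in> Dyck n"
    using hM nonneg dist_zero forced_zeros_simps by (auto simp: Dyck_def)
  have "height ?M c = 0" if "c \<in> ?F" for c
    using hM that dist_zero forced_zeros_simps(3) by auto
  then have MA: "?M \<in> ?A" using M by (simp add: meet_le_zero_path_iff)
  have le_M: "weakly_below n Z ?M" if "Z \<in> ?A" for Z
  proof -
    have Z: "Z \<in> Dyck n" "\<And>c. c \<in> ?F \<Longrightarrow> height Z c = 0"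
      using that by (auto simp: meet_le_zero_path_iff)
    then have "length Z = 2 * n" by (simp add: Dyck_def)
    then show ?thesis
      using Z(2) forced_zeros_simps(1-3)
      by (simp add: weakly_below_def hM height_le_distance_to)
  qed
  \<comment> \<open>The join is accessible only as a least upper bound: it lies below
    \<open>?M\<close>, which is an upper bound, and above \<open>?M\<close>, which is a
    member.\<close>
  have l: "least (Dyck_order n) (pseudocomplement n P) (Upper (Dyck_order n) ?A)"
    unfolding pseudocomplement_def rel_pseudocomplement_def
    using MA by (intro Dyck_join_least) auto
  have "?M \<in> Upper (Dyck_order n) ?A"
    using M le_M by (auto simp: Upper_def Dyck_order_def)
  then have "weakly_below n (pseudocomplement n P) ?M"
    using l by (auto simp: least_def Dyck_order_def)
  moreover have "weakly_below n ?M (pseudocomplement n P)" "pseudocomplement n P \<in> Dyck n"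
    using l MA by (auto simp: least_def Upper_def Dyck_order_def)
  ultimately have pc: "pseudocomplement n P \<in> Dyck n"
    "\<And>i. i \<le> 2 * n \<Longrightarrow> height (pseudocomplement n P) i = distance_to ?F i"
    by (auto simp: weakly_below_def hM intro: order.antisym)
  then show ?thesis
    by (auto simp: Dyck_def intro: path_eqI[of _ "2 * n"])
qed

section \<open>Hill sequences between consecutive forced zeros\<close>

lemma new_pyramid_consecutive:
  assumes "new_pyramid n P a b"
  shows "consecutive (forced_zeros n P) a b"
proof -
  from assms obtain x x' k where x: "hill_sequence P k x x'" "a = x - 2" "b = min (x' + 2) (2 * n)"
    and before: "\<And>c. c + 2 = x \<Longrightarrow> \<not> hill_at P c" and after: "\<not> hill_at P x'"
    by (auto simp: new_pyramid_def maximal_hill_sequence_def)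
  have x': "x' = x + 2 * k" and len: "length P = 2 * n"
    and hills: "\<And>i. i < k \<Longrightarrow> hill_at P (x + 2 * i)"
    and k0: "k = 0 \<Longrightarrow> 0 < x \<and> x < 2 * n" and hx: "height P x = 0"
    using x P by (auto simp: hill_sequence_def Dyck_def)
  \<comment> \<open>The first point is bounded by the first hill or, for \<open>k = 0\<close>, by
    the convention on empty sequences; every later point is the right end of a hill.\<close>
  have zero: "x + 2 * i \<le> 2 * n \<and> height P (x + 2 * i) = 0" if "i \<le> k" for i
  proof (cases i)
    case 0
    then show ?thesis using k0 hx hills[of 0] by (cases "k = 0") (auto simp: hill_at_iff[OF P])
  next
    case (Suc j)
    then show ?thesis using hills[of j] that by (auto simp: hill_at_iff[OF P] add.assoc)
  qed
  have le: "x' \<le> 2 * n" and hx': "height P x' = 0" using zero[of k] x' by auto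
  have ev: "even x" using Dyck_even_zero[OF P _ hx] zero[of 0] by auto
  \<comment> \<open>Were \<open>P\<close> on the axis two abscissas before \<open>x\<close>, a hill
    would precede the sequence, against maximality. The same argument applies after
    \<open>x'\<close>.\<close>
  have a: "a \<in> forced_zeros n P"
  proof (cases "x = 0")
    case True
    then show ?thesis using x forced_zeros_simps by simp
  next
    case False
    then have "2 \<le> x" using ev by presburger
    then have "a + 2 = x" "x \<le> 2 * n" using x zero[of 0] by auto
    then have "height P a \<noteq> 0" using before[of a] hx by (auto simp: hill_at_iff[OF P])
    then show ?thesis using \<open>a + 2 = x\<close> \<open>x \<le> 2 * n\<close> ev by (auto simp: forced_zeros_def)
  qed
  have b: "b \<in> forced_zeros n P"
  proof (cases "x' = 2 * n")
    case True
    then show ?thesis using x forced_zeros_simps by simp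
  next
    case False
    then have "x' + 2 \<le> 2 * n" using le ev x' by presburger
    moreover have "height P (x' + 2) \<noteq> 0"
      using after hx' calculation by (auto simp: hill_at_iff[OF P])
    ultimately show ?thesis using x x' ev by (auto simp: forced_zeros_def)
  qed
  \<comment> \<open>An empty sequence still gives a proper interval because its point is not an
    endpoint of the path; otherwise \<open>x < x'\<close> suffices.\<close>
  have "a < b" using x x' le k0 ev by (cases "k = 0") auto
  moreover have "\<not> (a < c \<and> c < b)" if "c \<in> forced_zeros n P" for c
  proof
    assume ac: "a < c \<and> c < b"
    have "even c" using that by (rule even_forced_zeros)
    moreover have "even x'" using ev x' by simp
    ultimately have "x \<le> c" "c \<le> x'" using ac x ev by presburger+
    moreover obtain i where "c = x + 2 * i" using \<open>x \<le> c\<close> \<open>even c\<close> ev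
      by (metis dvd_diff_nat evenE le_add_diff_inverse)
    ultimately have "height P c = 0" using zero[of i] x' by simp
    then show False using that ac x by (auto simp: forced_zeros_def)
  qed
  ultimately show ?thesis using a b by (simp add: consecutive_def)
qed

text \<open>By parity \<open>a\<close> and \<open>b\<close> are at least 4 apart. \<open>P\<close>
  vanishes at all even abscissas strictly between them, which makes these the points of a hill
  sequence. The sequence is empty exactly when \<open>b = a + 4\<close> and neither is an endpoint
  of the path.\<close>

lemma consecutive_new_pyramid:
  assumes ab: "consecutive (forced_zeros n P) a b" and far: "b \<noteq> a + 2"
  shows "new_pyramid n P a b"
proof -
  have fz: "a \<in> forced_zeros n P" "b \<in> forced_zeros n P" "a < b"
    and no: "\<And>c. c \<in> forced_zeros n P \<Longrightarrow> \<not> (a < c \<and> c < b)"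
    using ab by (auto simp: consecutive_def)
  then have ev: "even a" "even b" and bn: "b \<le> 2 * n"
    using even_forced_zeros forced_zeros_simps(3) by auto
  have ab4: "a + 4 \<le> b" using ev fz(3) far by presburger
  have len: "length P = 2 * n" using P by (simp add: Dyck_def)
  have ends: "height P 0 = 0" "height P (2 * n) = 0" using P by (auto simp: Dyck_def)
  have inner: "height P c = 0" if "even c" "a < c" "c < b" for c
    using no[of c] that bn by (auto simp: forced_zeros_def)
  \<comment> \<open>At a forced zero that is an endpoint of the path \<open>P\<close> vanishes, so
    the hills reach up to it; at any other one \<open>P\<close> is positive and they stop two
    abscissas short.\<close>
  define x where "x = (if a = 0 then 0 else a + 2)"
  define x' where "x' = (if b = 2 * n then 2 * n else b - 2)"
  have ev': "even x" "even x'" and xx': "x \<le> x'" using ev ab4 by (auto simp: x_def x'_def)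
  then obtain k where k: "x' = x + 2 * k"
    by (metis dvd_diff_nat evenE le_add_diff_inverse)
  have zero: "height P c = 0" if "even c" "x \<le> c" "c \<le> x'" for c
    using that inner[of c] ends ab4 bn by (cases "c = 0 \<or> c = 2 * n") (auto simp: x_def x'_def split: if_splits)
  have x'n: "x' \<le> 2 * n" using bn by (auto simp: x'_def)
  have hills: "hill_at P (x + 2 * i)" if "i < k" for i
    using that k ev' x'n zero[of "x + 2 * i"] zero[of "x + 2 * i + 2"]
    by (auto simp: hill_at_iff[OF P])
  have "hill_sequence P k x x'"
    using hills k zero[of x] ev' xx' ab4 bn len
    by (auto simp: hill_sequence_def x_def x'_def split: if_splits)
  moreover have "\<not> hill_at P c" if "c + 2 = x" for c
    using that fz forced_zero_iff[of a] ev bn by (auto simp: x_def hill_at_iff[OF P] split: if_splits)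
  \<comment> \<open>A hill could follow \<open>x'\<close> only if two more steps are left; it would
    then end at \<open>b\<close>, where \<open>P\<close> is positive.\<close>
  moreover have "x' + 2 = b \<and> b \<noteq> 2 * n" if "x' + 2 \<le> 2 * n"
    using that ab4 by (auto simp: x'_def split: if_splits)
  then have "\<not> hill_at P x'"
    using fz ab4 by (fastforce simp: hill_at_iff[OF P] forced_zeros_def)
  moreover have "a = x - 2" "b = min (x' + 2) (2 * n)"
    using ab4 bn ev by (auto simp: x_def x'_def elim!: evenE)
  ultimately show ?thesis
    unfolding new_pyramid_def maximal_hill_sequence_def by blast
qed

text \<open>Consecutive forced zeros bound either a new pyramid or an interval of length 2. No new
  pyramid covers the latter kind unless it coincides with it, by \<open>consecutive_unique\<close>,
  so the completing hills are pyramids between consecutive forced zeros too.\<close>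

lemma pyramids_completed_by_hills_iff:
  "pyramids_completed_by_hills n P Q \<longleftrightarrow>
    Q \<in> Dyck n \<and> (\<forall>a b. consecutive (forced_zeros n P) a b \<longrightarrow> pyramid_at Q a b)"
proof (intro iffI conjI allI impI)
  assume L: "pyramids_completed_by_hills n P Q"
  then show "Q \<in> Dyck n" by (simp add: pyramids_completed_by_hills_def)
  fix a b assume ab: "consecutive (forced_zeros n P) a b"
  show "pyramid_at Q a b"
  proof (cases "new_pyramid n P a b")
    case True
    then show ?thesis using L by (simp add: pyramids_completed_by_hills_def)
  next
    case False
    then have b: "b = a + 2" using ab consecutive_new_pyramid by blast
    have "even a" using ab even_forced_zeros by (auto simp: consecutive_def)
    then obtain i where i: "a = 2 * i" by (rule evenE)
    have "b \<le> 2 * n" using ab forced_zeros_simps(3) by (auto simp: consecutive_def)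
    then have "i < n" using b i by simp
    moreover have "\<not> (\<exists>a' b'. new_pyramid n P a' b' \<and> a' \<le> 2 * i \<and> 2 * i + 2 \<le> b')"
    proof clarify
      fix a' b' assume new: "new_pyramid n P a' b'" and "a' \<le> 2 * i" "2 * i + 2 \<le> b'"
      then have "a = a'" "b = b'"
        using consecutive_unique[OF ab new_pyramid_consecutive[OF new], of a] b i by auto
      then show False using new False by simp
    qed
    ultimately show ?thesis
      using L b i by (simp add: pyramids_completed_by_hills_def hill_at_def)
  qed
next
  assume R: "Q \<in> Dyck n \<and> (\<forall>a b. consecutive (forced_zeros n P) a b \<longrightarrow> pyramid_at Q a b)"
  have "hill_at Q (2 * i)"
    if i: "i < n" and no: "\<not> (\<exists>a b. new_pyramid n P a b \<and> a \<le> 2 * i \<and> 2 * i + 2 \<le> b)" for i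
  proof -
    obtain a b where ab: "consecutive (forced_zeros n P) a b" "a \<le> 2 * i" "2 * i < b"
      using i forced_zeros_simps consecutive_exists[of "forced_zeros n P" 0 "2 * n" "2 * i"] by auto
    have ev: "even a" "even b" using ab(1) even_forced_zeros by (auto simp: consecutive_def)
    \<comment> \<open>By parity the whole interval from \<open>2 * i\<close> to
      \<open>2 * i + 2\<close> lies between \<open>a\<close> and \<open>b\<close>, so
      \<open>no\<close> excludes a new pyramid there.\<close>
    then have "2 * i + 2 \<le> b" using ab by (auto elim!: evenE)
    then have "b = a + 2" using no ab consecutive_new_pyramid by blast
    then have "a = 2 * i" using ab \<open>2 * i + 2 \<le> b\<close> by simp
    then show ?thesis using R ab \<open>b = a + 2\<close> by (simp add: hill_at_def)
  qed
  then show "pyramids_completed_by_hills n P Q"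
    using R new_pyramid_consecutive by (auto simp: pyramids_completed_by_hills_def)
qed

text \<open>The intervals between consecutive forced zeros cover the whole path, and on each of them
  the distance has the profile of a pyramid.\<close>

lemma pyramids_iff_distance:
  assumes "n \<ge> 1" "Q \<in> Dyck n"
  shows "(\<forall>a b. consecutive (forced_zeros n P) a b \<longrightarrow> pyramid_at Q a b) \<longleftrightarrow>
    (\<forall>i\<le>2 * n. height Q i = distance_to (forced_zeros n P) i)"
proof (intro iffI allI impI)
  fix i assume all: "\<forall>a b. consecutive (forced_zeros n P) a b \<longrightarrow> pyramid_at Q a b"
    and i: "i \<le> 2 * n"
  have "\<exists>a b. consecutive (forced_zeros n P) a b \<and> a \<le> i \<and> i \<le> b"
  proof -
    \<comment> \<open>The intervals from \<open>consecutive_exists\<close> are half-open and miss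
      \<open>2 * n\<close>, hence the shift to \<open>i - 1\<close>. For \<open>i = 0\<close>
      truncation leaves 0, which is below \<open>2 * n\<close> as \<open>n \<ge> 1\<close>.\<close>
    have "0 \<le> (i - 1)" "i - 1 < 2 * n" using i assms by auto
    then obtain a b where "consecutive (forced_zeros n P) a b" "a \<le> i - 1" "i - 1 < b"
      using forced_zeros_simps consecutive_exists by metis
    then show ?thesis by (intro exI[of _ a] exI[of _ b]) auto
  qed
  then obtain a b where "consecutive (forced_zeros n P) a b" "a \<le> i" "i \<le> b" by blast
  then show "height Q i = distance_to (forced_zeros n P) i"
    using all forced_zeros_simps(1) by (simp add: distance_to_consecutive pyramid_at_iff)
next
  fix a b assume h: "\<forall>i\<le>2 * n. height Q i = distance_to (forced_zeros n P) i"
    and ab: "consecutive (forced_zeros n P) a b"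
  then have "a < b" "b \<le> 2 * n" "even a" "even b"
    using even_forced_zeros forced_zeros_simps(3) by (auto simp: consecutive_def)
  then show "pyramid_at Q a b"
    using h ab assms(2) forced_zeros_simps(1)
    by (auto simp: pyramid_at_iff distance_to_consecutive Dyck_def)
qed

end

theorem corollary2p1:
  fixes n :: nat and P :: "step list"
  assumes "n \<ge> 1" and "P \<in> Dyck n"
  shows "\<forall>Q. pyramids_completed_by_hills n P Q \<longleftrightarrow> Q = pseudocomplement n P"
  using pyramids_completed_by_hills_iff[OF assms(2)] eq_pseudocomplement_iff[OF assms(2)]
    pyramids_iff_distance[OF assms(2,1)] by blast

end
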